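(* Let $N$ be an $l\times n$ matrix with non-negative integer entries and columns $\mathbf b_1,\dots,\mathbf b_n$ with $\Gamma(N)=V(I_N)$ in $\bar K^n$, let $D$ be an $m\times l$ rational matrix with $M=DN$ integral (all columns nonzero), let $r_1=\mathrm{ht}(I_N)$, $r_2=\mathrm{ht}(I_M)$, $s=r_2-r_1$, and $\phi:K[x_1,\dots,x_n]\to K[t_1,\dots,t_l]$, $\phi(x_i)=\mathbf t^{\mathbf b_i}$. If there are polynomials $f_1,\dots,f_s\in I_M$ such that $\mathrm{rad}(I_{N(\ker_{\mathbb Z}(M))})=\mathrm{rad}(\phi(f_1),\dots,\phi(f_s))$, then $I_M=\mathrm{rad}(I_N+(f_1,\dots,f_s))$; in particular $I_M$ is a set-theoretic complete intersection on $I_N$.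
   Context: $K$ is a field with algebraic closure $\bar K$. $I_M$ is the toric ideal of $M$ (kernel of $x_i\mapsto\mathbf t^{\mathbf a_i}$, $\mathbf a_i$ the columns). $\Gamma(N)=\{(\mathbf T^{\mathbf b_1},\dots,\mathbf T^{\mathbf b_n}):\mathbf T\in\bar K^l\}$; $V(I_N)$ is the zero set of $I_N$ in $\bar K^n$. $\mathbf y_{\mathbf u}=\sum u_i\mathbf b_i$, $N(\ker_{\mathbb Z}(M))=\{\mathbf y_{\mathbf u}:\mathbf u\in\mathbb Z^n,M\mathbf u^T=0\}$, and $I_L=(\mathbf t^{\mathbf z_+}-\mathbf t^{\mathbf z_-}:\mathbf z\in L)$ is the lattice ideal of $L\subseteq\mathbb Z^l$. $I_M$ is a set-theoretic complete intersection on $I_N$ if $I_M=\mathrm{rad}(I_N+(f_1,\dots,f_s))$ for some $f_1,\dots,f_s\in I_M$ with $s=\mathrm{ht}(I_M)-\mathrm{ht}(I_N)$. *)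

theory Defs
  imports "HOL-Library.Poly_Mapping" "HOL-Algebra.Algebraic_Closure_Type"
begin

text \<open>Multivariate polynomials over a field 'k are represented as
  finitely supported maps from exponent vectors to 'k (monomial exponent vector to coefficient),
  Laurent polynomials analogously with integer exponent vectors.  Variables are indexed from 0:
  x_1..x_n are the indices 0..n-1, t_1..t_l are 0..l-1.
  Matrices are functions row \<Rightarrow> column \<Rightarrow> entry, relevant entries with
  row < number of rows and column < number of columns.\<close>

type_synonym 'k mpoly = "(nat \<Rightarrow>\<^sub>0 nat) \<Rightarrow>\<^sub>0 'k"
type_synonym 'k lpoly = "(nat \<Rightarrow>\<^sub>0 int) \<Rightarrow>\<^sub>0 'k"

definition polys :: "nat \<Rightarrow> 'k::field mpoly set" where
  "polys n = {p. \<forall>\<alpha>\<in>Poly_Mapping.keys p. \<forall>i\<in>Poly_Mapping.keys \<alpha>. i < n}"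

definition is_ideal :: "'a::comm_ring_1 set \<Rightarrow> 'a set \<Rightarrow> bool" where
  "is_ideal R I \<longleftrightarrow> I \<subseteq> R \<and> 0 \<in> I \<and> (\<forall>a\<in>I. \<forall>b\<in>I. a + b \<in> I)
     \<and> (\<forall>r\<in>R. \<forall>a\<in>I. r * a \<in> I)"

definition gen_ideal :: "'a::comm_ring_1 set \<Rightarrow> 'a set \<Rightarrow> 'a set" where
  "gen_ideal R S = \<Inter>{I. is_ideal R I \<and> S \<subseteq> I}"

definition rad :: "'a::comm_ring_1 set \<Rightarrow> 'a set \<Rightarrow> 'a set" where
  "rad R I = {p \<in> R. \<exists>k::nat. p ^ k \<in> I}"

definition is_prime_ideal :: "'a::comm_ring_1 set \<Rightarrow> 'a set \<Rightarrow> bool" where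
  "is_prime_ideal R P \<longleftrightarrow> is_ideal R P \<and> P \<noteq> R \<and>
     (\<forall>a\<in>R. \<forall>b\<in>R. a * b \<in> P \<longrightarrow> a \<in> P \<or> b \<in> P)"

definition prime_height :: "'a::comm_ring_1 set \<Rightarrow> 'a set \<Rightarrow> nat" where
  "prime_height R P = Sup {k. \<exists>c :: nat \<Rightarrow> 'a set.
      (\<forall>j\<le>k. is_prime_ideal R (c j)) \<and> (\<forall>j<k. c j \<subset> c (Suc j)) \<and> c k = P}"

definition height :: "'a::comm_ring_1 set \<Rightarrow> 'a set \<Rightarrow> nat" where
  "height R I = (INF P\<in>{P. is_prime_ideal R P \<and> I \<subseteq> P}. prime_height R P)"

text \<open>Exponent of t in the image of the monomial x^alpha under x_i \<mapsto> t^(a_i),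
  where a_i is column i of the m x n integer matrix A.\<close>
definition lexp :: "nat \<Rightarrow> nat \<Rightarrow> (nat \<Rightarrow> nat \<Rightarrow> int) \<Rightarrow> (nat \<Rightarrow>\<^sub>0 nat) \<Rightarrow> (nat \<Rightarrow>\<^sub>0 int)" where
  "lexp m n A \<alpha> = Abs_poly_mapping
     (\<lambda>k. if k < m then (\<Sum>i<n. int (Poly_Mapping.lookup \<alpha> i) * A k i) else 0)"

definition toric_map :: "nat \<Rightarrow> nat \<Rightarrow> (nat \<Rightarrow> nat \<Rightarrow> int) \<Rightarrow> 'k::field mpoly \<Rightarrow> 'k lpoly" where
  "toric_map m n A p = (\<Sum>\<alpha>\<in>Poly_Mapping.keys p. Poly_Mapping.single (lexp m n A \<alpha>) (Poly_Mapping.lookup p \<alpha>))"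

definition toric_ideal :: "nat \<Rightarrow> nat \<Rightarrow> (nat \<Rightarrow> nat \<Rightarrow> int) \<Rightarrow> 'k::field mpoly set" where
  "toric_ideal m n A = {p \<in> polys n. toric_map m n A p = 0}"

definition pexp :: "nat \<Rightarrow> nat \<Rightarrow> (nat \<Rightarrow> nat \<Rightarrow> nat) \<Rightarrow> (nat \<Rightarrow>\<^sub>0 nat) \<Rightarrow> (nat \<Rightarrow>\<^sub>0 nat)" where
  "pexp l n B \<alpha> = Abs_poly_mapping
     (\<lambda>k. if k < l then (\<Sum>i<n. Poly_Mapping.lookup \<alpha> i * B k i) else 0)"

definition phi :: "nat \<Rightarrow> nat \<Rightarrow> (nat \<Rightarrow> nat \<Rightarrow> nat) \<Rightarrow> 'k::field mpoly \<Rightarrow> 'k mpoly" where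
  "phi l n B p = (\<Sum>\<alpha>\<in>Poly_Mapping.keys p. Poly_Mapping.single (pexp l n B \<alpha>) (Poly_Mapping.lookup p \<alpha>))"

definition pos_part :: "nat \<Rightarrow> (nat \<Rightarrow> int) \<Rightarrow> (nat \<Rightarrow>\<^sub>0 nat)" where
  "pos_part l z = Abs_poly_mapping (\<lambda>k. if k < l then nat (z k) else 0)"

definition neg_part :: "nat \<Rightarrow> (nat \<Rightarrow> int) \<Rightarrow> (nat \<Rightarrow>\<^sub>0 nat)" where
  "neg_part l z = Abs_poly_mapping (\<lambda>k. if k < l then nat (- z k) else 0)"

definition lattice_ideal :: "nat \<Rightarrow> (nat \<Rightarrow> int) set \<Rightarrow> 'k::field mpoly set" where
  "lattice_ideal l L = gen_ideal (polys l)
     {Poly_Mapping.single (pos_part l z) 1 - Poly_Mapping.single (neg_part l z) 1 | z. z \<in> L}"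

definition image_kernel_lattice ::
  "nat \<Rightarrow> nat \<Rightarrow> nat \<Rightarrow> (nat \<Rightarrow> nat \<Rightarrow> nat) \<Rightarrow> (nat \<Rightarrow> nat \<Rightarrow> int) \<Rightarrow> (nat \<Rightarrow> int) set" where
  "image_kernel_lattice l m n N M =
     {(\<lambda>k. if k < l then (\<Sum>i<n. u i * int (N k i)) else 0) | u.
        (\<forall>j<m. (\<Sum>i<n. M j i * u i) = 0)}"

definition eval_ac :: "'k::field mpoly \<Rightarrow> (nat \<Rightarrow> 'k alg_closure) \<Rightarrow> 'k alg_closure" where
  "eval_ac p x = (\<Sum>\<alpha>\<in>Poly_Mapping.keys p. to_ac (Poly_Mapping.lookup p \<alpha>) * (\<Prod>i\<in>Poly_Mapping.keys \<alpha>. x i ^ Poly_Mapping.lookup \<alpha> i))"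

text \<open>Zero set V(I) in \<bar>K^n (points as functions; coordinates \<ge> n unconstrained).\<close>
definition zero_set :: "'k::field mpoly set \<Rightarrow> (nat \<Rightarrow> 'k alg_closure) set" where
  "zero_set I = {x. \<forall>p\<in>I. eval_ac p x = 0}"

definition Gamma :: "nat \<Rightarrow> nat \<Rightarrow> (nat \<Rightarrow> nat \<Rightarrow> nat) \<Rightarrow> (nat \<Rightarrow> 'k::field alg_closure) set" where
  "Gamma l n N = {x. \<exists>T :: nat \<Rightarrow> 'k alg_closure. \<forall>i<n. x i = (\<Prod>k<l. T k ^ N k i)}"

definition stci_on :: "nat \<Rightarrow> 'k::field mpoly set \<Rightarrow> 'k mpoly set \<Rightarrow> bool" where
  "stci_on n IM IN \<longleftrightarrow> (\<exists>f :: nat \<Rightarrow> 'k mpoly.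
     (\<forall>j < height (polys n) IM - height (polys n) IN. f j \<in> IM) \<and>
     IM = rad (polys n) (gen_ideal (polys n)
            (IN \<union> f ` {..< height (polys n) IM - height (polys n) IN})))"

end

theory Submission
  imports Defs
begin

text \<open>The Nullstellensatz is not needed. A radical is an intersection of primes, so let \<open>P\<close> be a prime
  containing \<open>I_N\<close> and the \<open>f_j\<close>, and let \<open>S\<close> be the set of all \<open>i\<close> with \<open>x_i \<notin> P\<close>. The indicator
  vector of \<open>S\<close> is a zero of \<open>I_N\<close>, hence it is parametrised by some \<open>T\<close>; the zero coordinates of \<open>T\<close>
  are disjoint from the support of column \<open>i\<close> of \<open>N\<close> exactly if \<open>i \<in> S\<close>. Discard from a
  polynomial in \<open>t\<close> all monomials whose exponent is not a difference of two \<open>\<nat>\<close>-combinations of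
  the columns in \<open>S\<close>. Because of the separation by \<open>T\<close>, this operation sends \<open>g * \<phi>(f_j)\<close> to the
  truncation of \<open>g\<close> times \<open>\<phi>\<close> of the truncation of \<open>f_j\<close> to the variables in \<open>S\<close>. Applied to a
  representation of \<open>\<phi>(q)^k\<close> by the \<open>\<phi>(f_j)\<close>, and multiplied by a monomial clearing denominators,
  it yields a relation in the image of \<open>\<phi>\<close>, which lifts modulo \<open>I_N\<close> and gives \<open>q \<in> P\<close>. Finally take
  for \<open>q\<close> the binomials that span \<open>I_M\<close>: the hypothesis on radicals applies to \<open>\<phi>(q)\<close>.\<close>

section \<open>Finitely supported maps: pushforward along a map of exponents, and truncation\<close>

lemma poly_mapping_eq_sum_single:
  "p = (\<Sum>a\<in>Poly_Mapping.keys p. Poly_Mapping.single a (Poly_Mapping.lookup p a))"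
proof (rule poly_mapping_eqI)
  fix k
  show "Poly_Mapping.lookup p k =
    Poly_Mapping.lookup (\<Sum>a\<in>Poly_Mapping.keys p. Poly_Mapping.single a (Poly_Mapping.lookup p a)) k"
    by (cases "k \<in> Poly_Mapping.keys p")
       (auto simp: lookup_sum lookup_single when_def sum.delta in_keys_iff)
qed

text \<open>The monomial case is limited to exponents that occur in \<open>p\<close>, so that a
  bound on the support of \<open>p\<close> stays available during the induction.\<close>

lemma poly_mapping_induct_single [case_names zero single add]:
  fixes p :: "'a \<Rightarrow>\<^sub>0 'b::comm_monoid_add"
  assumes "P 0"
    and "\<And>a c. a \<in> Poly_Mapping.keys p \<Longrightarrow> P (Poly_Mapping.single a c)"
    and "\<And>q r. P q \<Longrightarrow> P r \<Longrightarrow> P (q + r)"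
  shows "P p"
proof -
  have "P (\<Sum>a\<in>A. Poly_Mapping.single a (Poly_Mapping.lookup p a))"
    if "finite A" "A \<subseteq> Poly_Mapping.keys p" for A
    using that by (induction rule: finite_induct) (auto intro: assms)
  then show ?thesis
    using poly_mapping_eq_sum_single[of p] by (metis finite_keys order_refl)
qed

text \<open>Common form of \<open>toric_map\<close> and \<open>phi\<close>: the linear map of monoid
  algebras induced by a map \<open>h\<close> of exponents. It is multiplicative as soon as
  \<open>h\<close> is additive.\<close>

definition push :: "('a \<Rightarrow> 'b) \<Rightarrow> ('a \<Rightarrow>\<^sub>0 'k) \<Rightarrow> ('b \<Rightarrow>\<^sub>0 'k::comm_monoid_add)" where
  "push h p = (\<Sum>a\<in>Poly_Mapping.keys p. Poly_Mapping.single (h a) (Poly_Mapping.lookup p a))"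

lemma toric_map_eq_push: "toric_map m n A = push (lexp m n A)"
  by (simp add: fun_eq_iff toric_map_def push_def)

lemma phi_eq_push: "phi l n B = push (pexp l n B)"
  by (simp add: fun_eq_iff phi_def push_def)

lemma push_0 [simp]: "push h 0 = 0"
  by (simp add: push_def)

lemma push_single [simp]: "push h (Poly_Mapping.single a c) = Poly_Mapping.single (h a) c"
  by (cases "c = 0") (simp_all add: push_def)

lemma push_add: "push h (p + q) = push h p + push h q"
  unfolding push_def by (rule setsum_keys_plus_distrib) (simp_all add: single_add)

lemma push_diff:
  fixes p q :: "'a \<Rightarrow>\<^sub>0 'k::ab_group_add"
  shows "push h (p - q) = push h p - push h q"
  by (metis add_diff_cancel diff_add_cancel push_add)

lemma push_push: "push g (push h p) = push (g \<circ> h) p"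
  by (induction p rule: poly_mapping_induct_single) (simp_all add: push_add)

lemma push_mult:
  fixes p q :: "'a::monoid_add \<Rightarrow>\<^sub>0 'k::semiring_0"
  assumes h: "\<And>a b. h (a + b) = h a + h b"
  shows "push h (p * q) = push h p * push h q"
proof (induction p rule: poly_mapping_induct_single)
  case (single a c)
  show ?case
    by (induction q rule: poly_mapping_induct_single)
       (simp_all add: mult_single h push_add distrib_left)
qed (simp_all add: distrib_right push_add)

lemma push_power:
  fixes p :: "'a::monoid_add \<Rightarrow>\<^sub>0 'k::semiring_1"
  assumes "\<And>a b. h (a + b) = h a + h b" and "h 0 = 0"
  shows "push h (p ^ k) = push h p ^ k"
  by (induction k) (simp_all add: push_mult assms flip: single_one)

text \<open>The kernel of a pushforward is spanned by binomials. Choose one representative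
  \<open>r v\<close> in each fibre of \<open>h\<close> on the support of \<open>p\<close>. Pushing
  \<open>p\<close> along \<open>r \<circ> h\<close> factors through \<open>push h p\<close> and
  gives 0; subtracting this zero from \<open>p\<close> term by term leaves a sum of
  binomials.\<close>

lemma kernel_push_induct [consumes 1, case_names zero binomial add]:
  fixes p :: "'a \<Rightarrow>\<^sub>0 'k::ab_group_add"
  assumes p: "push h p = 0"
    and Q0: "Q 0"
    and Qb: "\<And>a b c. a \<in> Poly_Mapping.keys p \<Longrightarrow> b \<in> Poly_Mapping.keys p \<Longrightarrow> h a = h b \<Longrightarrow>
               Q (Poly_Mapping.single a c - Poly_Mapping.single b c)"
    and Qadd: "\<And>q r. Q q \<Longrightarrow> Q r \<Longrightarrow> Q (q + r)"
  shows "Q p"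
proof -
  define r where "r v = (SOME a. a \<in> Poly_Mapping.keys p \<and> h a = v)" for v
  have r: "r (h a) \<in> Poly_Mapping.keys p \<and> h (r (h a)) = h a" if "a \<in> Poly_Mapping.keys p" for a
    unfolding r_def by (rule someI[of _ a]) (use that in auto)
  have "push (r \<circ> h) p = 0"
    using p push_push[of r h p] by simp
  then have "p = (\<Sum>a\<in>Poly_Mapping.keys p. Poly_Mapping.single a (Poly_Mapping.lookup p a) -
       Poly_Mapping.single (r (h a)) (Poly_Mapping.lookup p a))"
    unfolding push_def by (simp add: sum_subtractf flip: poly_mapping_eq_sum_single)
  moreover have "Q (\<Sum>a\<in>A. Poly_Mapping.single a (Poly_Mapping.lookup p a) -
       Poly_Mapping.single (r (h a)) (Poly_Mapping.lookup p a))"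
    if "finite A" "A \<subseteq> Poly_Mapping.keys p" for A
    using that by (induction rule: finite_induct) (auto intro!: Q0 Qadd Qb simp: r)
  ultimately show ?thesis
    by (metis finite_keys order_refl)
qed

definition restr :: "'a set \<Rightarrow> ('a \<Rightarrow>\<^sub>0 'k) \<Rightarrow> ('a \<Rightarrow>\<^sub>0 'k::comm_monoid_add)" where
  "restr E = Poly_Mapping.mapp (\<lambda>a c. c when a \<in> E)"

lemma lookup_restr: "Poly_Mapping.lookup (restr E p) a = (Poly_Mapping.lookup p a when a \<in> E)"
  by (simp add: restr_def lookup_mapp when_def in_keys_iff)

lemma restr_0 [simp]: "restr E 0 = 0"
  by (rule poly_mapping_eqI) (simp add: lookup_restr)

lemma restr_add: "restr E (p + q) = restr E p + restr E q"
  by (rule poly_mapping_eqI) (simp add: lookup_restr lookup_add when_def)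

lemma restr_single:
  "restr E (Poly_Mapping.single a c) = (if a \<in> E then Poly_Mapping.single a c else 0)"
  by (rule poly_mapping_eqI) (auto simp: lookup_restr lookup_single when_def)

lemma keys_restr: "Poly_Mapping.keys (restr E p) = Poly_Mapping.keys p \<inter> E"
  by (auto simp: in_keys_iff lookup_restr when_def split: if_splits)

section \<open>Exponent vectors and their degrees\<close>

lemma lookup_lexp:
  "Poly_Mapping.lookup (lexp m n A \<alpha>) k =
     (if k < m then (\<Sum>i<n. int (Poly_Mapping.lookup \<alpha> i) * A k i) else 0)"
proof -
  have "finite {k. (if k < m then (\<Sum>i<n. int (Poly_Mapping.lookup \<alpha> i) * A k i) else 0) \<noteq> 0}"
    by (rule finite_subset[of _ "{..<m}"]) auto
  then show ?thesis
    unfolding lexp_def by simp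
qed

lemma lookup_pexp:
  "Poly_Mapping.lookup (pexp l n B \<alpha>) k =
     (if k < l then (\<Sum>i<n. Poly_Mapping.lookup \<alpha> i * B k i) else 0)"
proof -
  have "finite {k. (if k < l then (\<Sum>i<n. Poly_Mapping.lookup \<alpha> i * B k i) else 0) \<noteq> 0}"
    by (rule finite_subset[of _ "{..<l}"]) auto
  then show ?thesis
    unfolding pexp_def by simp
qed

lemma lookup_pos_part:
  "Poly_Mapping.lookup (pos_part l z) k = (if k < l then nat (z k) else 0)"
proof -
  have "finite {k. (if k < l then nat (z k) else 0) \<noteq> 0}"
    by (rule finite_subset[of _ "{..<l}"]) auto
  then show ?thesis
    unfolding pos_part_def by simp
qed

lemma lookup_neg_part:
  "Poly_Mapping.lookup (neg_part l z) k = (if k < l then nat (- z k) else 0)"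
proof -
  have "finite {k. (if k < l then nat (- z k) else 0) \<noteq> 0}"
    by (rule finite_subset[of _ "{..<l}"]) auto
  then show ?thesis
    unfolding neg_part_def by simp
qed

lemma keys_pos_part_subset: "Poly_Mapping.keys (pos_part l z) \<subseteq> {..<l}"
  by (auto simp: in_keys_iff lookup_pos_part split: if_splits)

lemma keys_neg_part_subset: "Poly_Mapping.keys (neg_part l z) \<subseteq> {..<l}"
  by (auto simp: in_keys_iff lookup_neg_part split: if_splits)

lemma lexp_0 [simp]: "lexp m n A 0 = 0"
  by (rule poly_mapping_eqI) (simp add: lookup_lexp)

lemma lexp_add: "lexp m n A (\<alpha> + \<beta>) = lexp m n A \<alpha> + lexp m n A \<beta>"
  by (rule poly_mapping_eqI)
     (simp add: lookup_lexp lookup_add distrib_right sum.distrib)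

lemma pexp_0 [simp]: "pexp l n B 0 = 0"
  by (rule poly_mapping_eqI) (simp add: lookup_pexp)

lemma pexp_add: "pexp l n B (\<alpha> + \<beta>) = pexp l n B \<alpha> + pexp l n B \<beta>"
  by (rule poly_mapping_eqI)
     (simp add: lookup_pexp lookup_add distrib_right sum.distrib)

text \<open>Links the two codings of the degree given by one matrix: natural exponents for
  \<open>phi\<close>, integer ones for \<open>toric_map\<close>.\<close>

lemma pexp_eq_imp_lexp_eq:
  assumes "pexp l n B \<alpha> = pexp l n B \<beta>"
  shows "lexp l n (\<lambda>k i. int (B k i)) \<alpha> = lexp l n (\<lambda>k i. int (B k i)) \<beta>"
proof (rule poly_mapping_eqI)
  have *: "int (Poly_Mapping.lookup (pexp l n B \<gamma>) k) =
      Poly_Mapping.lookup (lexp l n (\<lambda>k i. int (B k i)) \<gamma>) k" for \<gamma> k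
    by (simp add: lookup_lexp lookup_pexp)
  show "Poly_Mapping.lookup (lexp l n (\<lambda>k i. int (B k i)) \<alpha>) k =
      Poly_Mapping.lookup (lexp l n (\<lambda>k i. int (B k i)) \<beta>) k" for k
    by (simp only: assms flip: *)
qed

lemma keys_pexp_subset: "Poly_Mapping.keys (pexp l n B \<alpha>) \<subseteq> {..<l}"
  by (auto simp: in_keys_iff lookup_pexp split: if_splits)

section \<open>Polynomials in finitely many variables, ideals and primes\<close>

lemma polys_0 [simp]: "0 \<in> polys n"
  by (simp add: polys_def)

lemma polys_1 [simp]: "1 \<in> polys n"
  by (simp add: polys_def)

lemma polys_add: "p \<in> polys n \<Longrightarrow> q \<in> polys n \<Longrightarrow> p + q \<in> polys n"
  unfolding polys_def using keys_add[of p q] by blast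

lemma polys_uminus: "p \<in> polys n \<Longrightarrow> - p \<in> polys n"
  by (simp add: polys_def)

lemma polys_diff: "p \<in> polys n \<Longrightarrow> q \<in> polys n \<Longrightarrow> p - q \<in> polys n"
  using polys_add[of p n "- q"] by (simp add: polys_uminus)

lemma polys_mult:
  assumes "p \<in> polys n" "q \<in> polys n"
  shows "p * q \<in> polys n"
  unfolding polys_def
proof safe
  fix \<alpha> i assume "\<alpha> \<in> Poly_Mapping.keys (p * q)" and i: "i \<in> Poly_Mapping.keys \<alpha>"
  then obtain a b where "\<alpha> = a + b" "a \<in> Poly_Mapping.keys p" "b \<in> Poly_Mapping.keys q"
    using keys_mult[of p q] by blast
  then show "i < n"
    using i keys_add[of a b] assms unfolding polys_def by blast
qed

lemma polys_power: "p \<in> polys n \<Longrightarrow> p ^ k \<in> polys n"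
  by (induction k) (simp_all add: polys_mult)

lemma polys_single: "Poly_Mapping.keys \<alpha> \<subseteq> {..<n} \<Longrightarrow> Poly_Mapping.single \<alpha> c \<in> polys n"
  by (auto simp: polys_def)

lemma polys_keysD: "p \<in> polys n \<Longrightarrow> \<alpha> \<in> Poly_Mapping.keys p \<Longrightarrow> Poly_Mapping.keys \<alpha> \<subseteq> {..<n}"
  by (auto simp: polys_def)

lemma polys_restr: "p \<in> polys n \<Longrightarrow> restr E p \<in> polys n"
  by (auto simp: polys_def keys_restr)

lemma phi_in_polys: "phi l n B p \<in> polys l"
  by (induction p rule: poly_mapping_induct_single)
     (simp_all add: phi_eq_push push_add polys_add polys_single keys_pexp_subset)

lemma is_ideal_polys: "is_ideal (polys n) (polys n)"
  by (simp add: is_ideal_def polys_add polys_mult)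

lemma gen_ideal_least: "is_ideal R I \<Longrightarrow> S \<subseteq> I \<Longrightarrow> gen_ideal R S \<subseteq> I"
  unfolding gen_ideal_def by blast

lemma gen_ideal_superset: "S \<subseteq> gen_ideal R S"
  unfolding gen_ideal_def by blast

text \<open>\<open>R\<close> is itself one of the ideals being intersected, which keeps the
  intersection inside \<open>R\<close>.\<close>

lemma is_ideal_gen_ideal: "is_ideal R R \<Longrightarrow> S \<subseteq> R \<Longrightarrow> is_ideal R (gen_ideal R S)"
  unfolding gen_ideal_def is_ideal_def by simp blast

lemma is_ideal_uminus: "is_ideal (polys n) I \<Longrightarrow> a \<in> I \<Longrightarrow> - a \<in> I"
  unfolding is_ideal_def by (metis mult_minus1 polys_1 polys_uminus)

lemma is_ideal_diff: "is_ideal (polys n) I \<Longrightarrow> a \<in> I \<Longrightarrow> b \<in> I \<Longrightarrow> a - b \<in> I"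
  using is_ideal_uminus[of n I b] unfolding is_ideal_def by (metis add_uminus_conv_diff)

text \<open>By Zorn's lemma there is an ideal maximal among those that contain \<open>I\<close> and
  no power of \<open>p\<close>; maximality makes it prime.\<close>

lemma exists_prime_ideal_avoiding_powers:
  fixes I :: "'k::field mpoly set"
  assumes I: "is_ideal (polys n) I" and p: "p \<in> polys n" and np: "\<And>k. p ^ k \<notin> I"
  shows "\<exists>P. is_prime_ideal (polys n) P \<and> I \<subseteq> P \<and> p \<notin> P"
proof -
  define R :: "'k mpoly set" where "R = polys n"
  define F where "F = {J. is_ideal R J \<and> I \<subseteq> J \<and> (\<forall>k. p ^ k \<notin> J)}"
  have "\<exists>P\<in>F. \<forall>J\<in>F. P \<subseteq> J \<longrightarrow> J = P"
  proof (rule subset_Zorn_nonempty)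
    show "F \<noteq> {}"
      using I np by (auto simp: F_def R_def)
    fix C assume C: "C \<noteq> {}" "subset.chain F C"
    then have CF: "\<And>J. J \<in> C \<Longrightarrow> J \<in> F" and chain: "\<And>J K. J \<in> C \<Longrightarrow> K \<in> C \<Longrightarrow> J \<subseteq> K \<or> K \<subseteq> J"
      by (auto simp: subset.chain_def)
    have id: "is_ideal R J" "I \<subseteq> J" "p ^ k \<notin> J" if "J \<in> C" for J k
      using CF[OF that] by (auto simp: F_def)
    obtain J0 where J0: "J0 \<in> C"
      using C(1) by blast
    have "is_ideal R (\<Union>C)"
      unfolding is_ideal_def
    proof (intro conjI ballI)
      show "\<Union>C \<subseteq> R"
        using id(1) unfolding is_ideal_def by blast
      show "0 \<in> \<Union>C"
        using id(1)[OF J0] J0 unfolding is_ideal_def by blast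
      show "r * a \<in> \<Union>C" if "r \<in> R" "a \<in> \<Union>C" for r a
        using id(1) that unfolding is_ideal_def by blast
      fix a b assume "a \<in> \<Union>C" "b \<in> \<Union>C"
      then obtain J where "J \<in> C" "a \<in> J" "b \<in> J"
        using chain by blast
      then show "a + b \<in> \<Union>C"
        using id(1)[of J] unfolding is_ideal_def by blast
    qed
    then show "\<Union>C \<in> F"
      using id(2)[OF J0] J0 id(3) unfolding F_def by blast
  qed
  then obtain P where P: "P \<in> F" and max: "\<And>J. J \<in> F \<Longrightarrow> P \<subseteq> J \<Longrightarrow> J = P"
    by blast
  have idP: "is_ideal R P" and IP: "I \<subseteq> P" and npP: "\<And>k. p ^ k \<notin> P"
    using P by (auto simp: F_def)
  have PR: "P \<subseteq> R" and P0: "0 \<in> P" and Padd: "\<And>a b. a \<in> P \<Longrightarrow> b \<in> P \<Longrightarrow> a + b \<in> P"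
    and Pmult: "\<And>r a. r \<in> R \<Longrightarrow> a \<in> P \<Longrightarrow> r * a \<in> P"
    using idP by (auto simp: is_ideal_def)
  \<comment> \<open>For \<open>a\<close> outside \<open>P\<close>, the ideal \<open>P + R a\<close>,
    called \<open>J\<close> below, is strictly larger than \<open>P\<close>, so by maximality it
    contains a power of \<open>p\<close>.\<close>
  have power_in: "\<exists>k r. r \<in> R \<and> p ^ k - r * a \<in> P" if a: "a \<in> R" "a \<notin> P" for a
  proof -
    define J where "J = {q \<in> R. \<exists>r\<in>R. q - r * a \<in> P}"
    have "is_ideal R J"
      unfolding is_ideal_def
    proof (intro conjI ballI)
      show "J \<subseteq> R" "0 \<in> J"
        using P0 by (auto simp: J_def R_def intro!: bexI[of _ 0])
      show "x + y \<in> J" if "x \<in> J" "y \<in> J" for x y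
      proof -
        from that obtain r s where "r \<in> R" "s \<in> R" "x - r * a \<in> P" "y - s * a \<in> P" "x \<in> R" "y \<in> R"
          by (auto simp: J_def)
        moreover have "x + y - (r + s) * a = (x - r * a) + (y - s * a)"
          by (simp add: algebra_simps)
        ultimately have "x + y - (r + s) * a \<in> P" "r + s \<in> R" "x + y \<in> R"
          using Padd[of "x - r * a" "y - s * a"] by (auto simp only: R_def polys_add)
        then show ?thesis
          unfolding J_def by blast
      qed
      show "s * x \<in> J" if "s \<in> R" "x \<in> J" for s x
      proof -
        from that obtain r where "r \<in> R" "x - r * a \<in> P" "x \<in> R"
          by (auto simp: J_def)
        moreover have "s * x - (s * r) * a = s * (x - r * a)"
          by (simp add: algebra_simps)
        ultimately have "s * x - (s * r) * a \<in> P" "s * r \<in> R" "s * x \<in> R"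
          using that(1) Pmult[of s "x - r * a"] by (auto simp only: R_def polys_mult)
        then show ?thesis
          unfolding J_def by blast
      qed
    qed
    moreover have "P \<subseteq> J"
      using PR by (auto simp: J_def R_def intro!: bexI[of _ 0])
    moreover have "a \<in> J"
      using a P0 by (auto simp: J_def R_def intro!: bexI[of _ 1])
    ultimately have "J \<notin> F"
      using max a by blast
    with \<open>is_ideal R J\<close> \<open>P \<subseteq> J\<close> IP obtain k where "p ^ k \<in> J"
      by (auto simp: F_def)
    then show ?thesis
      by (auto simp: J_def)
  qed
  have "a \<in> P \<or> b \<in> P" if ab: "a \<in> R" "b \<in> R" "a * b \<in> P" for a b
  proof (rule ccontr)
    assume "\<not> (a \<in> P \<or> b \<in> P)"
    with power_in ab obtain j k r s where
      r: "r \<in> R" "p ^ j - r * a \<in> P" and s: "s \<in> R" "p ^ k - s * b \<in> P"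
      by metis
    \<comment> \<open>Multiplying the congruences of \<open>p ^ j\<close> with \<open>r * a\<close>
      and of \<open>p ^ k\<close> with \<open>s * b\<close> modulo \<open>P\<close>, written out as
      an identity.\<close>
    have "p ^ (j + k) = p ^ k * (p ^ j - r * a) + (r * a) * (p ^ k - s * b) + (r * s) * (a * b)"
      by (simp add: algebra_simps power_add)
    moreover have "p ^ k * (p ^ j - r * a) \<in> P" "(r * a) * (p ^ k - s * b) \<in> P"
        "(r * s) * (a * b) \<in> P"
      using r s ab p by (auto intro!: Pmult simp: R_def polys_mult polys_power)
    ultimately have "p ^ (j + k) \<in> P"
      using Padd by simp
    with npP show False
      by blast
  qed
  moreover have "P \<noteq> R"
    using npP[of 0] by (auto simp: R_def)
  ultimately show ?thesis
    using idP IP npP[of 1] unfolding is_prime_ideal_def R_def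
    by (intro exI[of _ P]) simp
qed

section \<open>Toric ideals and the images of their binomials\<close>

lemma toric_ideal_diff_single:
  assumes "Poly_Mapping.keys \<alpha> \<subseteq> {..<n}" "Poly_Mapping.keys \<beta> \<subseteq> {..<n}" "lexp m n A \<alpha> = lexp m n A \<beta>"
  shows "Poly_Mapping.single \<alpha> c - Poly_Mapping.single \<beta> c \<in> toric_ideal m n A"
  using assms by (simp add: toric_ideal_def toric_map_eq_push push_diff polys_diff polys_single)

lemma is_ideal_toric_ideal: "is_ideal (polys n) (toric_ideal m n A)"
  by (auto simp: is_ideal_def toric_ideal_def polys_add polys_mult toric_map_eq_push push_add
      push_mult lexp_add)

text \<open>Toric ideals are radical: \<open>toric_map\<close> is a ring homomorphism into Laurent
  polynomials, which have no nonzero nilpotents.\<close>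

lemma toric_ideal_power_mem:
  assumes "p \<in> polys n" "p ^ k \<in> toric_ideal m n A"
  shows "p \<in> toric_ideal m n A"
  using assms by (auto simp: toric_ideal_def toric_map_eq_push push_power lexp_add)

text \<open>Relations between images under \<open>phi\<close> can thus be lifted modulo the toric
  ideal of the matrix; on the binomials spanning the kernel only degrees have to be
  compared.\<close>

lemma phi_eq_0_imp_toric:
  assumes "p \<in> polys n" "phi l n B p = 0"
  shows "p \<in> toric_ideal l n (\<lambda>k i. int (B k i))"
proof -
  have "push (pexp l n B) p = 0"
    using assms(2) by (simp add: phi_eq_push)
  then show ?thesis
  proof (induction p rule: kernel_push_induct)
    case (binomial a b c)
    then show ?case
      using assms(1) by (intro toric_ideal_diff_single polys_keysD pexp_eq_imp_lexp_eq)
  qed (use is_ideal_toric_ideal[of n l "\<lambda>k i. int (B k i)"] in \<open>auto simp: is_ideal_def\<close>)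
qed

lemma toric_ideal_mono:
  assumes "\<And>\<alpha> \<beta>. lexp l n A \<alpha> = lexp l n A \<beta> \<Longrightarrow> lexp m n B \<alpha> = lexp m n B \<beta>"
  shows "toric_ideal l n A \<subseteq> toric_ideal m n B"
proof
  fix p :: "'a mpoly" assume "p \<in> toric_ideal l n A"
  then have "push (lexp l n A) p = 0" and p: "p \<in> polys n"
    by (auto simp: toric_ideal_def toric_map_eq_push)
  from this(1) show "p \<in> toric_ideal m n B"
  proof (induction p rule: kernel_push_induct)
    case (binomial a b c)
    then show ?case
      using p by (intro toric_ideal_diff_single polys_keysD assms)
  qed (use is_ideal_toric_ideal[of n m B] in \<open>auto simp: is_ideal_def\<close>)
qed

text \<open>The degree by \<open>M\<close> is \<open>D\<close> applied to the degree by
  \<open>N\<close>; the computation runs over the rationals because \<open>D\<close> is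
  rational.\<close>

lemma lexp_factor:
  assumes M_DN: "\<forall>j<m. \<forall>i<n. of_int (M j i) = (\<Sum>k<l. D j k * (of_nat (N k i) :: rat))"
    and eq: "lexp l n (\<lambda>k i. int (N k i)) \<alpha> = lexp l n (\<lambda>k i. int (N k i)) \<beta>"
  shows "lexp m n M \<alpha> = lexp m n M \<beta>"
proof (rule poly_mapping_eqI)
  fix j
  have *: "of_int (Poly_Mapping.lookup (lexp m n M \<gamma>) j) =
      (\<Sum>k<l. D j k * of_int (Poly_Mapping.lookup (lexp l n (\<lambda>k i. int (N k i)) \<gamma>) k))"
    if "j < m" for \<gamma>
  proof -
    have "(of_int (Poly_Mapping.lookup (lexp m n M \<gamma>) j) :: rat) =
        (\<Sum>i<n. of_nat (Poly_Mapping.lookup \<gamma> i) * (\<Sum>k<l. D j k * of_nat (N k i)))"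
      using that M_DN by (simp add: lookup_lexp)
    also have "\<dots> = (\<Sum>i<n. \<Sum>k<l. D j k * (of_nat (Poly_Mapping.lookup \<gamma> i) * of_nat (N k i)))"
      by (simp add: sum_distrib_left mult.left_commute)
    also have "\<dots> = (\<Sum>k<l. \<Sum>i<n. D j k * (of_nat (Poly_Mapping.lookup \<gamma> i) * of_nat (N k i)))"
      by (rule sum.swap)
    also have "\<dots> = (\<Sum>k<l. D j k * of_int (Poly_Mapping.lookup (lexp l n (\<lambda>k i. int (N k i)) \<gamma>) k))"
      by (simp add: lookup_lexp sum_distrib_left)
    finally show ?thesis .
  qed
  show "Poly_Mapping.lookup (lexp m n M \<alpha>) j = Poly_Mapping.lookup (lexp m n M \<beta>) j"
  proof (cases "j < m")
    case True
    then have "(of_int (Poly_Mapping.lookup (lexp m n M \<alpha>) j) :: rat) =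
        of_int (Poly_Mapping.lookup (lexp m n M \<beta>) j)"
      by (simp only: * eq)
    then show ?thesis
      by simp
  qed (simp add: lookup_lexp)
qed

text \<open>The difference \<open>u\<close> of the two exponents lies in the kernel of
  \<open>M\<close>, and \<open>z\<close> is its image under \<open>N\<close>. Taking the common
  monomial factor out of the image of the binomial leaves the generator belonging to
  \<open>z\<close>, times \<open>c\<close>.\<close>

lemma phi_binomial_in_lattice_ideal:
  assumes eq: "lexp m n M \<alpha> = lexp m n M \<beta>"
  shows "phi l n N (Poly_Mapping.single \<alpha> c - Poly_Mapping.single \<beta> c)
    \<in> lattice_ideal l (image_kernel_lattice l m n N M)"
proof -
  define u where "u i = int (Poly_Mapping.lookup \<alpha> i) - int (Poly_Mapping.lookup \<beta> i)" for i
  define z where "z = (\<lambda>k. if k < l then (\<Sum>i<n. u i * int (N k i)) else 0)"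
  have "(\<Sum>i<n. M j i * u i) = 0" if "j < m" for j
    using that arg_cong[OF eq, of "\<lambda>v. Poly_Mapping.lookup v j"]
    by (simp add: lookup_lexp u_def algebra_simps sum_subtractf)
  then have z: "z \<in> image_kernel_lattice l m n N M"
    unfolding image_kernel_lattice_def z_def by blast
  \<comment> \<open>This is the componentwise minimum of the two image exponents: the positive part
    of \<open>z\<close> never exceeds the first one, so the natural subtraction does not
    truncate.\<close>
  define d where "d = pexp l n N \<alpha> - pos_part l z"
  have zk: "z k = int (Poly_Mapping.lookup (pexp l n N \<alpha>) k) - int (Poly_Mapping.lookup (pexp l n N \<beta>) k)" for k
    by (simp add: z_def u_def lookup_pexp algebra_simps sum_subtractf)
  have \<alpha>: "pexp l n N \<alpha> = d + pos_part l z" and \<beta>: "pexp l n N \<beta> = d + neg_part l z"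
  proof -
    have "Poly_Mapping.lookup (pexp l n N \<gamma>) k = 0" if "\<not> k < l" for \<gamma> k
      using that by (simp add: lookup_pexp)
    then show "pexp l n N \<alpha> = d + pos_part l z" "pexp l n N \<beta> = d + neg_part l z"
      by (auto intro!: poly_mapping_eqI
          simp: lookup_add lookup_minus lookup_pos_part lookup_neg_part d_def zk nat_minus_as_int)
  qed
  have d: "Poly_Mapping.keys d \<subseteq> {..<l}"
    by (auto simp: d_def in_keys_iff lookup_minus lookup_pexp split: if_splits)
  let ?G = "{Poly_Mapping.single (pos_part l z) 1 - Poly_Mapping.single (neg_part l z) 1 | z.
     z \<in> image_kernel_lattice l m n N M} :: 'a mpoly set"
  have "?G \<subseteq> polys l"
    by (auto intro!: polys_diff polys_single
        dest!: subsetD[OF keys_pos_part_subset] subsetD[OF keys_neg_part_subset])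
  then have "is_ideal (polys l) (gen_ideal (polys l) ?G)"
    by (intro is_ideal_gen_ideal is_ideal_polys)
  moreover have "Poly_Mapping.single (pos_part l z) 1 - Poly_Mapping.single (neg_part l z) 1 \<in> gen_ideal (polys l) ?G"
    by (rule subsetD[OF gen_ideal_superset]) (use z in blast)
  moreover have "Poly_Mapping.single d c \<in> polys l"
    using d by (rule polys_single)
  ultimately have "Poly_Mapping.single d c * (Poly_Mapping.single (pos_part l z) 1 - Poly_Mapping.single (neg_part l z) 1)
     \<in> gen_ideal (polys l) ?G"
    by (simp add: is_ideal_def)
  moreover have "phi l n N (Poly_Mapping.single \<alpha> c - Poly_Mapping.single \<beta> c) =
     Poly_Mapping.single d c * (Poly_Mapping.single (pos_part l z) 1 - Poly_Mapping.single (neg_part l z) 1)"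
    by (simp add: phi_eq_push push_diff \<alpha> \<beta> right_diff_distrib mult_single)
  ultimately show ?thesis
    by (simp add: lattice_ideal_def)
qed

section \<open>Evaluation at points, and monomials modulo a prime ideal\<close>

lemma eval_ac_add: "eval_ac (p + q) x = eval_ac p x + eval_ac q x"
  unfolding eval_ac_def by (rule setsum_keys_plus_distrib) (simp_all add: distrib_right)

lemma eval_ac_diff: "eval_ac (p - q) x = eval_ac p x - eval_ac q x"
  by (metis add_diff_cancel diff_add_cancel eval_ac_add)

lemma eval_ac_single:
  "eval_ac (Poly_Mapping.single \<alpha> c) x =
     to_ac c * (\<Prod>i\<in>Poly_Mapping.keys \<alpha>. x i ^ Poly_Mapping.lookup \<alpha> i)"
  by (cases "c = 0") (simp_all add: eval_ac_def)

text \<open>A product of variables lies in a prime exactly if one of its factors does. The empty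
  product is covered because a proper ideal does not contain 1.\<close>

lemma single_mem_prime_iff:
  fixes P :: "'k::field mpoly set"
  assumes P: "is_prime_ideal (polys n) P" and \<alpha>: "Poly_Mapping.keys \<alpha> \<subseteq> {..<n}"
  shows "Poly_Mapping.single \<alpha> 1 \<in> P \<longleftrightarrow>
    \<not> Poly_Mapping.keys \<alpha> \<subseteq> {i. Poly_Mapping.single (Poly_Mapping.single i 1) 1 \<notin> P}"
proof
  have idP: "is_ideal (polys n) P" and prime: "\<And>a b. a \<in> polys n \<Longrightarrow> b \<in> polys n \<Longrightarrow> a * b \<in> P \<Longrightarrow> a \<in> P \<or> b \<in> P"
    using P by (auto simp: is_prime_ideal_def)
  have "1 \<notin> P"
  proof
    assume "1 \<in> P"
    then have "r \<in> P" if "r \<in> polys n" for r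
      using idP that unfolding is_ideal_def by (metis mult.right_neutral)
    then show False
      using P idP by (auto simp: is_prime_ideal_def is_ideal_def)
  qed
  {
    assume *: "Poly_Mapping.keys \<alpha> \<subseteq> {i. Poly_Mapping.single (Poly_Mapping.single i 1) 1 \<notin> P}"
    have "Poly_Mapping.keys \<alpha> \<subseteq> {..<n} \<and> Poly_Mapping.single \<alpha> 1 \<notin> P"
    proof (induction \<alpha> rule: poly_mapping_induct_single)
      case zero
      then show ?case using \<open>1 \<notin> P\<close> by simp
    next
      case (single i c)
      have i: "i < n" "Poly_Mapping.single (Poly_Mapping.single i 1) 1 \<notin> P"
        using single * \<alpha> by auto
      have "Poly_Mapping.single (Poly_Mapping.single i c) (1::'k) \<notin> P"
      proof (induction c)
        case 0
        then show ?case using \<open>1 \<notin> P\<close> by simp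
      next
        case (Suc c)
        have "Poly_Mapping.single (Poly_Mapping.single i (Suc c)) (1::'k) =
           Poly_Mapping.single (Poly_Mapping.single i 1) 1 * Poly_Mapping.single (Poly_Mapping.single i c) 1"
          by (simp add: mult_single flip: single_add)
        moreover have "Poly_Mapping.single (Poly_Mapping.single i k) (1::'k) \<in> polys n" for k
          using i(1) by (intro polys_single) auto
        ultimately show ?case
          using Suc i(2) prime by metis
      qed
      then show ?case
        using i by auto
    next
      case (add q r)
      have "Poly_Mapping.single (q + r) (1::'k) = Poly_Mapping.single q 1 * Poly_Mapping.single r 1"
        by (simp add: mult_single)
      moreover have "Poly_Mapping.keys (q + r) \<subseteq> {..<n}"
        using keys_add[of q r] add by blast
      ultimately show ?case
        using add prime by (metis polys_single)
    qed
  }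
  then show "Poly_Mapping.single \<alpha> 1 \<in> P \<Longrightarrow>
    \<not> Poly_Mapping.keys \<alpha> \<subseteq> {i. Poly_Mapping.single (Poly_Mapping.single i 1) 1 \<notin> P}"
    by blast
  assume "\<not> Poly_Mapping.keys \<alpha> \<subseteq> {i. Poly_Mapping.single (Poly_Mapping.single i 1) 1 \<notin> P}"
  then obtain i where i: "i \<in> Poly_Mapping.keys \<alpha>" "Poly_Mapping.single (Poly_Mapping.single i 1) 1 \<in> P"
    by blast
  define \<gamma> where "\<gamma> = \<alpha> - Poly_Mapping.single i 1"
  have "\<alpha> = \<gamma> + Poly_Mapping.single i 1"
    by (rule poly_mapping_eqI) (use i in \<open>auto simp: \<gamma>_def lookup_add lookup_minus lookup_single when_def in_keys_iff\<close>)
  then have "Poly_Mapping.single \<alpha> (1::'k) = Poly_Mapping.single \<gamma> 1 * Poly_Mapping.single (Poly_Mapping.single i 1) 1"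
    by (simp add: mult_single)
  moreover have "Poly_Mapping.keys \<gamma> \<subseteq> {..<n}"
    using \<alpha> by (auto simp: \<gamma>_def in_keys_iff lookup_minus subset_iff)
  ultimately show "Poly_Mapping.single \<alpha> 1 \<in> P"
    using idP i by (metis is_ideal_def polys_single)
qed

text \<open>At this point a monomial takes the value 0 if it lies in \<open>P\<close> and 1
  otherwise. The two monomials of a binomial in \<open>P\<close> are both inside or both outside, so
  the binomials spanning the toric ideal vanish there.\<close>

lemma indicator_in_zero_set_toric_ideal:
  fixes P :: "'k::field mpoly set"
  assumes P: "is_prime_ideal (polys n) P" and sub: "toric_ideal l n A \<subseteq> P"
  shows "(\<lambda>i. if Poly_Mapping.single (Poly_Mapping.single i 1) 1 \<notin> P then 1 else 0)
    \<in> zero_set (toric_ideal l n A :: 'k mpoly set)"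
  unfolding zero_set_def
proof safe
  let ?x = "\<lambda>i. if Poly_Mapping.single (Poly_Mapping.single i 1) 1 \<notin> P then 1 else 0 :: 'k alg_closure"
  have eval: "eval_ac (Poly_Mapping.single \<alpha> c) ?x =
      (if Poly_Mapping.single \<alpha> 1 \<in> P then 0 else to_ac c)" if \<alpha>: "Poly_Mapping.keys \<alpha> \<subseteq> {..<n}" for \<alpha> c
  proof (cases "Poly_Mapping.single \<alpha> 1 \<in> P")
    case True
    then obtain i where "i \<in> Poly_Mapping.keys \<alpha>" "Poly_Mapping.single (Poly_Mapping.single i 1) 1 \<in> P"
      using single_mem_prime_iff[OF P \<alpha>] by blast
    then have "(\<Prod>i\<in>Poly_Mapping.keys \<alpha>. ?x i ^ Poly_Mapping.lookup \<alpha> i) = 0"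
      by (intro prod_zero bexI[of _ i]) (auto simp: in_keys_iff)
    with True show ?thesis
      by (simp add: eval_ac_single)
  next
    case False
    then have "?x i = 1" if "i \<in> Poly_Mapping.keys \<alpha>" for i
      using that single_mem_prime_iff[OF P \<alpha>] by auto
    then have "(\<Prod>i\<in>Poly_Mapping.keys \<alpha>. ?x i ^ Poly_Mapping.lookup \<alpha> i) = 1"
      by (intro prod.neutral ballI) simp
    with False show ?thesis
      by (simp add: eval_ac_single)
  qed
  fix p :: "'k mpoly" assume "p \<in> toric_ideal l n A"
  then have "push (lexp l n A) p = 0" and p: "p \<in> polys n"
    by (auto simp: toric_ideal_def toric_map_eq_push)
  from this(1) show "eval_ac p ?x = 0"
  proof (induction p rule: kernel_push_induct)
    case zero
    then show ?case by (simp add: eval_ac_def)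
  next
    case (binomial a b c)
    have ab: "Poly_Mapping.keys a \<subseteq> {..<n}" "Poly_Mapping.keys b \<subseteq> {..<n}"
      using binomial p by (auto dest: polys_keysD)
    have idP: "is_ideal (polys n) P"
      using P by (simp add: is_prime_ideal_def)
    have d: "Poly_Mapping.single a 1 - Poly_Mapping.single b 1 \<in> P"
      using toric_ideal_diff_single[OF ab binomial(3)] sub by blast
    have "Poly_Mapping.single b 1 \<in> P" if "Poly_Mapping.single a 1 \<in> P"
      using is_ideal_diff[OF idP that d] by simp
    moreover have "Poly_Mapping.single a 1 \<in> P" if "Poly_Mapping.single b 1 \<in> P"
      using idP that d unfolding is_ideal_def by (metis diff_add_cancel)
    ultimately show ?case
      unfolding eval_ac_diff eval[OF ab(1)] eval[OF ab(2)] by auto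
  next
    case (add q r)
    then show ?case by (simp add: eval_ac_add)
  qed
qed

section \<open>Truncation relative to a prime ideal\<close>

lemma restr_diff_mem_prime:
  fixes P :: "'k::field mpoly set"
  assumes P: "is_ideal (polys n) P" and r: "r \<in> polys n"
    and W: "\<And>\<alpha>. Poly_Mapping.keys \<alpha> \<subseteq> {..<n} \<Longrightarrow> \<alpha> \<notin> W \<Longrightarrow> Poly_Mapping.single \<alpha> 1 \<in> P"
  shows "r - restr W r \<in> P"
proof (induction r rule: poly_mapping_induct_single)
  case (single a c)
  then have a: "Poly_Mapping.keys a \<subseteq> {..<n}"
    using r polys_keysD by blast
  \<comment> \<open>A discarded monomial lies in \<open>P\<close> by assumption; its coefficient is
    restored by multiplying with a constant.\<close>
  have "Poly_Mapping.single a c \<in> P" if "a \<notin> W"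
  proof -
    have "Poly_Mapping.single 0 c * Poly_Mapping.single a 1 \<in> P"
      using P W[OF a that] unfolding is_ideal_def by (simp add: polys_single)
    then show ?thesis
      by (simp add: mult_single)
  qed
  then show ?case
    using P by (simp add: restr_single is_ideal_def)
next
  case (add q r)
  then have "(q - restr W q) + (r - restr W r) \<in> P"
    using P by (simp add: is_ideal_def)
  then show ?case
    by (simp add: restr_add algebra_simps)
qed (use P in \<open>simp add: is_ideal_def\<close>)

text \<open>Transfers membership from the ring of the \<open>t\<close> variables back to a single
  prime \<open>P\<close>. The equality of \<open>Gamma\<close> with the zero set enters only through
  the parametrisation \<open>T\<close> of the indicator point.\<close>

lemma prime_mem_if_phi_power_mem:
  fixes P F :: "'k::field mpoly set"
  assumes Gamma_V: "Gamma l n N = zero_set (toric_ideal l n (\<lambda>k i. int (N k i)) :: 'k mpoly set)"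
    and P: "is_prime_ideal (polys n) P"
    and toric_P: "toric_ideal l n (\<lambda>k i. int (N k i)) \<subseteq> P"
    and FP: "F \<subseteq> P"
    and q: "q \<in> polys n"
    and phi_q: "phi l n N q ^ k \<in> gen_ideal (polys l) (phi l n N ` F)"
  shows "q \<in> P"
proof -
  let ?e = "pexp l n N" and ?X = "\<lambda>\<alpha>. Poly_Mapping.single \<alpha> (1::'k)"
  have idP: "is_ideal (polys n) P" and prime: "\<And>a b. a \<in> polys n \<Longrightarrow> b \<in> polys n \<Longrightarrow> a * b \<in> P \<Longrightarrow> a \<in> P \<or> b \<in> P"
    using P by (auto simp: is_prime_ideal_def)
  have PR: "P \<subseteq> polys n" and P0: "0 \<in> P" and Padd: "\<And>a b. a \<in> P \<Longrightarrow> b \<in> P \<Longrightarrow> a + b \<in> P"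
    and Pmult: "\<And>r a. r \<in> polys n \<Longrightarrow> a \<in> P \<Longrightarrow> r * a \<in> P"
    using idP by (auto simp: is_ideal_def)
  define S where "S = {i. ?X (Poly_Mapping.single i 1) \<notin> P}"
  define W :: "(nat \<Rightarrow>\<^sub>0 nat) set" where "W = {\<alpha>. Poly_Mapping.keys \<alpha> \<subseteq> {..<n} \<and> Poly_Mapping.keys \<alpha> \<subseteq> S}"
  have W0: "0 \<in> W" and Wadd: "\<And>\<alpha> \<beta>. \<alpha> \<in> W \<Longrightarrow> \<beta> \<in> W \<Longrightarrow> \<alpha> + \<beta> \<in> W"
    by (auto simp: W_def dest!: subsetD[OF keys_add])
  have keys_W: "Poly_Mapping.keys \<alpha> \<subseteq> {..<n}" if "\<alpha> \<in> W" for \<alpha>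
    using that by (simp add: W_def)
  have XP: "?X \<alpha> \<in> P \<longleftrightarrow> \<alpha> \<notin> W" if "Poly_Mapping.keys \<alpha> \<subseteq> {..<n}" for \<alpha>
    using single_mem_prime_iff[OF P that] that by (simp add: W_def S_def)
  obtain T :: "nat \<Rightarrow> 'k alg_closure"
    where T: "\<And>i. i < n \<Longrightarrow> (if i \<in> S then 1 else 0) = (\<Prod>k<l. T k ^ N k i)"
    using indicator_in_zero_set_toric_ideal[OF P toric_P]
    unfolding Gamma_V[symmetric] by (auto simp: Gamma_def S_def)
  \<comment> \<open>The product is nonzero exactly if every vanishing \<open>T k\<close> occurs with
    exponent 0, by the convention that the zeroth power of 0 is 1.\<close>
  have S_iff: "i \<in> S \<longleftrightarrow> (\<forall>k<l. T k = 0 \<longrightarrow> N k i = 0)" if "i < n" for i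
  proof -
    have "i \<in> S \<longleftrightarrow> (\<Prod>k<l. T k ^ N k i) \<noteq> 0"
      unfolding T[OF that, symmetric] by simp
    also have "\<dots> \<longleftrightarrow> (\<forall>k<l. T k = 0 \<longrightarrow> N k i = 0)"
      by (auto simp: prod_zero_iff)
    finally show ?thesis .
  qed
  \<comment> \<open>Membership of an exponent in \<open>W\<close> thus depends only on its image
    under \<open>?e\<close>, which is what allows truncation on both sides of \<open>phi\<close> to
    be compared.\<close>
  have W_iff: "\<alpha> \<in> W \<longleftrightarrow> (\<forall>k<l. T k = 0 \<longrightarrow> Poly_Mapping.lookup (?e \<alpha>) k = 0)"
    if "Poly_Mapping.keys \<alpha> \<subseteq> {..<n}" for \<alpha>
  proof -
    have "\<alpha> \<in> W \<longleftrightarrow> (\<forall>i<n. Poly_Mapping.lookup \<alpha> i = 0 \<or> i \<in> S)"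
    proof
      assume "\<alpha> \<in> W"
      then have "Poly_Mapping.keys \<alpha> \<subseteq> S"
        by (simp add: W_def)
      then show "\<forall>i<n. Poly_Mapping.lookup \<alpha> i = 0 \<or> i \<in> S"
        by (metis in_keys_iff subsetD)
    next
      assume "\<forall>i<n. Poly_Mapping.lookup \<alpha> i = 0 \<or> i \<in> S"
      then have "i \<in> S" if "i \<in> Poly_Mapping.keys \<alpha>" for i
        using that \<open>Poly_Mapping.keys \<alpha> \<subseteq> {..<n}\<close> by (metis in_keys_iff lessThan_iff subsetD)
      then show "\<alpha> \<in> W"
        using that by (auto simp: W_def)
    qed
    also have "\<dots> \<longleftrightarrow> (\<forall>k<l. T k = 0 \<longrightarrow> (\<forall>i<n. Poly_Mapping.lookup \<alpha> i * N k i = 0))"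
      unfolding mult_eq_0_iff by (metis S_iff)
    also have "\<dots> \<longleftrightarrow> (\<forall>k<l. T k = 0 \<longrightarrow> Poly_Mapping.lookup (?e \<alpha>) k = 0)"
      by (simp add: lookup_pexp Ball_def)
    finally show ?thesis .
  qed
  \<comment> \<open>exponents lying in the group generated by the columns in \<open>S\<close>, written without subtraction\<close>
  define E where "E = {v. \<exists>\<gamma>\<in>W. \<exists>\<delta>\<in>W. v + ?e \<delta> = ?e \<gamma>}"
  have E0: "0 \<in> E"
    using W0 by (auto simp: E_def)
  \<comment> \<open>The separation by \<open>T\<close> acts here: \<open>?e \<alpha>\<close> is
    bounded by some \<open>?e \<gamma>\<close> with \<open>\<gamma>\<close> in \<open>W\<close>, so
    it also vanishes wherever \<open>T\<close> does, which puts \<open>\<alpha>\<close> into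
    \<open>W\<close>.\<close>
  have E_iff: "v + ?e \<alpha> \<in> E \<longleftrightarrow> v \<in> E \<and> \<alpha> \<in> W" if \<alpha>: "Poly_Mapping.keys \<alpha> \<subseteq> {..<n}" for v \<alpha>
  proof
    assume "v + ?e \<alpha> \<in> E"
    then obtain \<gamma> \<delta> where *: "\<gamma> \<in> W" "\<delta> \<in> W" "v + ?e \<alpha> + ?e \<delta> = ?e \<gamma>"
      by (auto simp: E_def)
    have "Poly_Mapping.lookup (?e \<alpha>) k \<le> Poly_Mapping.lookup (?e \<gamma>) k" for k
      unfolding *(3)[symmetric] by (simp add: lookup_add)
    moreover have "\<forall>k<l. T k = 0 \<longrightarrow> Poly_Mapping.lookup (?e \<gamma>) k = 0"
      using W_iff[OF keys_W[OF *(1)]] *(1) by simp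
    ultimately have "\<alpha> \<in> W"
      unfolding W_iff[OF \<alpha>] by (metis le_zero_eq)
    moreover have "v + ?e (\<alpha> + \<delta>) = ?e \<gamma>"
      using * by (simp add: pexp_add add.assoc)
    ultimately show "v \<in> E \<and> \<alpha> \<in> W"
      using * Wadd unfolding E_def by blast
  next
    assume "v \<in> E \<and> \<alpha> \<in> W"
    then obtain \<gamma> \<delta> where *: "\<gamma> \<in> W" "\<delta> \<in> W" "v + ?e \<delta> = ?e \<gamma>" "\<alpha> \<in> W"
      by (auto simp: E_def)
    then have "v + ?e \<alpha> + ?e \<delta> = ?e (\<gamma> + \<alpha>)"
      by (simp add: pexp_add ac_simps flip: *(3))
    then show "v + ?e \<alpha> \<in> E"
      using * Wadd unfolding E_def by blast
  qed
  have restr_E: "restr E (Poly_Mapping.single v c * phi l n N r) =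
      (if v \<in> E then Poly_Mapping.single v c * phi l n N (restr W r) else 0)"
    if r: "r \<in> polys n" for v c and r :: "'k mpoly"
  proof (induction r rule: poly_mapping_induct_single)
    case (single a d)
    then show ?case
      using E_iff[OF polys_keysD[OF r single], of v]
      by (auto simp: phi_eq_push mult_single restr_single)
  qed (auto simp: phi_eq_push push_add distrib_left restr_add)
  have restr_P: "restr W r \<in> P" if "r \<in> P" for r
  proof -
    have "r - restr W r \<in> P"
      using that PR XP by (intro restr_diff_mem_prime[OF idP]) auto
    then show ?thesis
      using is_ideal_diff[OF idP that] by fastforce
  qed

  \<comment> \<open>\<open>J\<^sub>0\<close> need not be an ideal, since \<open>restr E\<close> is not multiplicative; \<open>J\<close> below is.\<close>
  define J\<^sub>0 where "J\<^sub>0 = {h. \<exists>\<delta>\<in>W. \<exists>r\<in>P. ?X (?e \<delta>) * restr E h = phi l n N r}"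
  have J0_0: "0 \<in> J\<^sub>0"
    using W0 P0 by (auto simp: J\<^sub>0_def phi_eq_push intro!: bexI[of _ 0])
  have J0_add: "h + h' \<in> J\<^sub>0" if h: "h \<in> J\<^sub>0" "h' \<in> J\<^sub>0" for h h'
  proof -
    obtain \<delta> r where r: "\<delta> \<in> W" "r \<in> P" "?X (?e \<delta>) * restr E h = phi l n N r"
      using h by (auto simp: J\<^sub>0_def)
    obtain \<delta>' r' where r': "\<delta>' \<in> W" "r' \<in> P" "?X (?e \<delta>') * restr E h' = phi l n N r'"
      using h by (auto simp: J\<^sub>0_def)
    \<comment> \<open>The two relations are brought to a common denominator.\<close>
    have "?X (?e (\<delta> + \<delta>')) * restr E (h + h') =
        ?X (?e \<delta>') * (?X (?e \<delta>) * restr E h) + ?X (?e \<delta>) * (?X (?e \<delta>') * restr E h')"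
      by (simp add: restr_add distrib_left mult_single pexp_add add.commute flip: mult.assoc)
    also have "\<dots> = phi l n N (?X \<delta>' * r + ?X \<delta> * r')"
      unfolding r r' by (simp add: phi_eq_push push_add push_mult pexp_add)
    finally have "?X (?e (\<delta> + \<delta>')) * restr E (h + h') = phi l n N (?X \<delta>' * r + ?X \<delta> * r')" .
    moreover have "?X \<delta>' * r + ?X \<delta> * r' \<in> P"
      using r r' by (intro Padd Pmult polys_single keys_W)
    ultimately show ?thesis
      using Wadd r r' unfolding J\<^sub>0_def by blast
  qed
  have J0_phi: "g * phi l n N r \<in> J\<^sub>0" if r: "r \<in> P" for g r
  proof (induction g rule: poly_mapping_induct_single)
    case zero
    then show ?case using J0_0 by simp
  next
    case (single v c)
    show ?case
    proof (cases "v \<in> E")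
      case True
      then obtain \<gamma> \<delta> where *: "\<gamma> \<in> W" "\<delta> \<in> W" "v + ?e \<delta> = ?e \<gamma>"
        by (auto simp: E_def)
      \<comment> \<open>The factor belonging to \<open>\<delta>\<close> turns \<open>v\<close> into
        the image exponent \<open>?e \<gamma>\<close>, so the product becomes an image under
        \<open>phi\<close>.\<close>
      have "?X (?e \<delta>) * restr E (Poly_Mapping.single v c * phi l n N r) =
          Poly_Mapping.single (v + ?e \<delta>) c * phi l n N (restr W r)"
        using True r PR by (subst restr_E) (auto simp: mult_single add.commute simp flip: mult.assoc)
      also have "\<dots> = phi l n N (Poly_Mapping.single \<gamma> c * restr W r)"
        unfolding * by (simp add: phi_eq_push push_mult pexp_add)
      finally have "?X (?e \<delta>) * restr E (Poly_Mapping.single v c * phi l n N r) =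
          phi l n N (Poly_Mapping.single \<gamma> c * restr W r)" .
      moreover have "Poly_Mapping.single \<gamma> c * restr W r \<in> P"
        using * r restr_P by (intro Pmult polys_single keys_W)
      ultimately show ?thesis
        using * unfolding J\<^sub>0_def by blast
    next
      case False
      then have "restr E (Poly_Mapping.single v c * phi l n N r) = 0"
        using restr_E r PR by auto
      then show ?thesis
        using W0 P0 by (auto simp: J\<^sub>0_def phi_eq_push intro!: bexI[of _ 0])
    qed
  next
    case (add g h)
    then show ?case by (simp add: distrib_right J0_add)
  qed
  define J where "J = {h \<in> polys l. \<forall>g\<in>polys l. g * h \<in> J\<^sub>0}"
  have "is_ideal (polys l) J"
    using J0_0 J0_add
    by (auto simp: is_ideal_def J_def polys_add polys_mult distrib_left simp flip: mult.assoc)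
  moreover have "phi l n N ` F \<subseteq> J"
    using FP J0_phi by (auto simp: J_def phi_in_polys)
  ultimately have "phi l n N q ^ k \<in> J"
    using gen_ideal_least phi_q by blast
  \<comment> \<open>The multiplier 1 leads from \<open>J\<close> back to a concrete relation in
    \<open>J\<^sub>0\<close>.\<close>
  then have "1 * phi l n N q ^ k \<in> J\<^sub>0"
    unfolding J_def using polys_1 by blast
  then obtain \<delta> r where r: "\<delta> \<in> W" "r \<in> P"
    "?X (?e \<delta>) * restr E (phi l n N (q ^ k)) = phi l n N r"
    by (auto simp: J\<^sub>0_def phi_eq_push push_power pexp_add)
  have \<delta>: "?X \<delta> \<in> polys n" "?X \<delta> \<notin> P"
    using r XP by (auto simp: W_def intro: polys_single)
  have qk: "q ^ k \<in> polys n"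
    using q by (rule polys_power)
  have "restr E (phi l n N (q ^ k)) = phi l n N (restr W (q ^ k))"
    using restr_E[OF qk, of 0 1] E0 by simp
  \<comment> \<open>Both sides of the relation are now images under \<open>phi\<close>, so the
    difference of their preimages lies in the toric ideal of \<open>N\<close>, hence in
    \<open>P\<close>.\<close>
  then have "phi l n N (?X \<delta> * restr W (q ^ k) - r) = 0"
    using r(3) by (simp add: phi_eq_push push_diff push_mult pexp_add)
  moreover have "?X \<delta> * restr W (q ^ k) - r \<in> polys n"
    using \<delta>(1) polys_restr[OF qk] r(2) PR by (auto intro!: polys_diff polys_mult)
  ultimately have "?X \<delta> * restr W (q ^ k) - r \<in> P"
    using phi_eq_0_imp_toric toric_P by blast
  then have "?X \<delta> * restr W (q ^ k) \<in> P"
    using Padd[OF _ r(2)] by fastforce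
  then have "restr W (q ^ k) \<in> P"
    using prime \<delta> polys_restr[OF qk] by blast
  moreover have "q ^ k - restr W (q ^ k) \<in> P"
    using XP by (intro restr_diff_mem_prime[OF idP qk]) auto
  ultimately have "q ^ k \<in> P"
    using Padd by fastforce
  \<comment> \<open>For exponent 0 the assumption puts 1 into \<open>P\<close>, which the monomial
    of \<open>\<delta>\<close> outside \<open>P\<close> contradicts.\<close>
  moreover have "q ^ j \<in> P \<Longrightarrow> q \<in> P" for j
  proof (induction j)
    case 0
    then have "s \<in> P" if "s \<in> polys n" for s
      using Pmult[OF that, of 1] by simp
    with \<delta> show ?case by blast
  next
    case (Suc j)
    then show ?case using prime[OF q polys_power[OF q]] by auto
  qed
  ultimately show ?thesis
    by blast
qed

section \<open>The toric ideal of \<open>M\<close> as a radical over the toric ideal of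
  \<open>N\<close>\<close>

theorem theorem5p3:
  fixes l m n :: nat
    and N :: "nat \<Rightarrow> nat \<Rightarrow> nat"
    and D :: "nat \<Rightarrow> nat \<Rightarrow> rat"
    and M :: "nat \<Rightarrow> nat \<Rightarrow> int"
    and f :: "nat \<Rightarrow> 'k::field mpoly"
  assumes Gamma_V: "Gamma l n N = zero_set (toric_ideal l n (\<lambda>k i. int (N k i)) :: 'k mpoly set)"
    and M_DN: "\<forall>j<m. \<forall>i<n. of_int (M j i) = (\<Sum>k<l. D j k * of_nat (N k i))"
    and M_cols: "\<forall>i<n. \<exists>j<m. M j i \<noteq> 0"
    and f_in: "\<forall>j < height (polys n) (toric_ideal m n M :: 'k mpoly set)
                     - height (polys n) (toric_ideal l n (\<lambda>k i. int (N k i)) :: 'k mpoly set).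
                 f j \<in> toric_ideal m n M"
    and rad_eq: "rad (polys l) (lattice_ideal l (image_kernel_lattice l m n N M) :: 'k mpoly set) =
       rad (polys l) (gen_ideal (polys l) (phi l n N ` f ` {..< height (polys n) (toric_ideal m n M :: 'k mpoly set)
                     - height (polys n) (toric_ideal l n (\<lambda>k i. int (N k i)) :: 'k mpoly set)}))"
  shows "toric_ideal m n M = rad (polys n) (gen_ideal (polys n)
            (toric_ideal l n (\<lambda>k i. int (N k i)) \<union> f ` {..< height (polys n) (toric_ideal m n M :: 'k mpoly set)
                     - height (polys n) (toric_ideal l n (\<lambda>k i. int (N k i)) :: 'k mpoly set)}))
      \<and> stci_on n (toric_ideal m n M) (toric_ideal l n (\<lambda>k i. int (N k i)) :: 'k mpoly set)"
proof -
  define s where "s = height (polys n) (toric_ideal m n M :: 'k mpoly set)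
                     - height (polys n) (toric_ideal l n (\<lambda>k i. int (N k i)) :: 'k mpoly set)"
  define IM IN :: "'k mpoly set"
    where "IM = toric_ideal m n M" and "IN = toric_ideal l n (\<lambda>k i. int (N k i))"
  define F where "F = f ` {..<s}"
  let ?I = "gen_ideal (polys n) (IN \<union> F)"
  have F: "F \<subseteq> IM"
    using f_in by (auto simp: F_def IM_def s_def)
  have IM: "is_ideal (polys n) IM" and IN: "IN \<subseteq> IM"
    unfolding IM_def IN_def
    by (rule is_ideal_toric_ideal) (rule toric_ideal_mono, rule lexp_factor[OF M_DN])
  then have I: "is_ideal (polys n) ?I"
    using F by (intro is_ideal_gen_ideal is_ideal_polys) (auto simp: is_ideal_def)
  have "IM = rad (polys n) ?I"
  proof (intro equalityI subsetI)
    fix p assume p: "p \<in> rad (polys n) ?I"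
    \<comment> \<open>The easy inclusion: all generators lie in \<open>IM\<close>, and
      \<open>IM\<close> is radical.\<close>
    moreover have "?I \<subseteq> IM"
      using IM IN F by (intro gen_ideal_least) auto
    ultimately show "p \<in> IM"
      unfolding rad_def IM_def using toric_ideal_power_mem by blast
  next
    fix p assume "p \<in> IM"
    then have p: "p \<in> polys n" "push (lexp m n M) p = 0"
      by (auto simp: IM_def toric_ideal_def toric_map_eq_push)
    show "p \<in> rad (polys n) ?I"
    proof (rule ccontr)
      assume "p \<notin> rad (polys n) ?I"
      then obtain P where P: "is_prime_ideal (polys n) P" "?I \<subseteq> P" "p \<notin> P"
        using exists_prime_ideal_avoiding_powers[OF I p(1)] p(1) by (auto simp: rad_def)
      have sub: "IN \<subseteq> P" "F \<subseteq> P"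
        using P(2) gen_ideal_superset by blast+
      have "p \<in> P"
        using p(2)
      proof (induction p rule: kernel_push_induct)
        \<comment> \<open>The binomials arising here have equal degree by \<open>M\<close>, so
          \<open>phi\<close> maps them into the lattice ideal, where the hypothesis on radicals
          applies.\<close>
        case (binomial a b c)
        define q where "q = Poly_Mapping.single a c - Poly_Mapping.single b c"
        have q: "q \<in> polys n"
          unfolding q_def using binomial p(1)
          by (intro polys_diff polys_single polys_keysD)
        have "phi l n N q \<in> rad (polys l) (lattice_ideal l (image_kernel_lattice l m n N M))"
          unfolding rad_def q_def
          using phi_binomial_in_lattice_ideal[OF binomial(3), of l N c] phi_in_polys
          by (auto intro!: exI[of _ 1])
        then obtain k where "phi l n N q ^ k \<in> gen_ideal (polys l) (phi l n N ` F)"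
          unfolding rad_eq by (auto simp: rad_def F_def s_def)
        then show ?case
          unfolding q_def[symmetric]
          using prime_mem_if_phi_power_mem[OF Gamma_V P(1)] sub q unfolding IN_def by blast
      qed (use P(1) in \<open>auto simp: is_prime_ideal_def is_ideal_def\<close>)
      with P(3) show False ..
    qed
  qed
  \<comment> \<open>The given \<open>f\<close> is itself the witness, since \<open>s\<close> is the
    difference of heights that \<open>stci_on\<close> prescribes.\<close>
  moreover have "stci_on n IM IN"
    unfolding stci_on_def using f_in calculation
    by (intro exI[of _ f]) (simp add: F_def IM_def IN_def s_def)
  ultimately show ?thesis
    by (simp add: F_def IM_def IN_def s_def)
qed

end
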